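(* Let $m \geq 2$ and let $u \in C^2(\mathbb{R}^m)$ be a real-valued solution of $\nabla^2 u - u = 0$ on $\mathbb{R}^m$. If there exist a constant $C > 0$ and a nonnegative integer $n$ such that \[ |u(x)| \leq C(1+|x|)^n \quad \text{for all } x \in \mathbb{R}^m, \] then $u$ vanishes identically.
   Context: $\nabla^2$ denotes the Laplacian on $\mathbb{R}^m$. *)

theory Defs
  imports "HOL-Analysis.Analysis"
begin

definition partially_differentiable :: "'m \<Rightarrow> (real ^ 'm \<Rightarrow> real) \<Rightarrow> real ^ 'm \<Rightarrow> bool"
  where "partially_differentiable i f x \<longleftrightarrow>
    (\<lambda>t. f (x + t *\<^sub>R axis i 1)) differentiable (at 0)"

(* Meaningful only where the partial derivative exists: deriv is otherwise unspecified. *)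
definition partial_deriv :: "'m \<Rightarrow> (real ^ 'm \<Rightarrow> real) \<Rightarrow> real ^ 'm \<Rightarrow> real"
  where "partial_deriv i f x = deriv (\<lambda>t. f (x + t *\<^sub>R axis i 1)) 0"

(* C_k k f: f is of class C^k on the whole space, i.e. all (mixed) partial derivatives of f
   of order at most k exist and are continuous. *)
primrec C_k :: "nat \<Rightarrow> (real ^ 'm \<Rightarrow> real) \<Rightarrow> bool"
  where
    "C_k 0 f \<longleftrightarrow> continuous_on UNIV f"
  | "C_k (Suc k) f \<longleftrightarrow> continuous_on UNIV f \<and>
       (\<forall>i. (\<forall>x. partially_differentiable i f x) \<and> C_k k (partial_deriv i f))"

definition laplacian :: "(real ^ 'm \<Rightarrow> real) \<Rightarrow> real ^ 'm \<Rightarrow> real"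
  where "laplacian f x = (\<Sum>i\<in>UNIV. partial_deriv i (partial_deriv i f) x)"

end

theory Submission
  imports Defs "HOL-Real_Asymp.Real_Asymp"
begin

text \<open>
  The theorem follows from the maximum principle with an explicit barrier.  The function
  \<open>w(x) = (\<Sum>i. cosh (x\<^sub>i))\<close> is a positive solution of \<open>\<nabla>\<^sup>2 w = w\<close> on the whole space and grows
  exponentially in every direction (\<open>exp_norm_le_cosh_barrier\<close>), so it dominates every function
  of polynomial growth.  For \<open>\<epsilon> > 0\<close>, the function \<open>v = u - \<epsilon> w\<close> is therefore negative outside a
  ball.  If \<open>v\<close> were positive somewhere, it would have a positive global maximum; there every pure
  second partial derivative is at most zero, hence \<open>\<nabla>\<^sup>2 v \<le> 0\<close>, whereas \<open>\<nabla>\<^sup>2 v = v > 0\<close>.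
  So \<open>u \<le> \<epsilon> w\<close> for all \<open>\<epsilon> > 0\<close>, that is, \<open>u \<le> 0\<close> (\<open>polynomially_bounded_subsolution_nonpos\<close>).
  The same argument for \<open>-u\<close> gives \<open>u = 0\<close>.
\<close>

text \<open>
  If the second derivative were positive, the first derivative, which vanishes at the maximum,
  would be positive just to the right of it and the function would increase there.
\<close>

lemma second_derivative_nonpos_at_maximum:
  fixes g g' :: "real \<Rightarrow> real"
  assumes g: "\<And>t. (g has_real_derivative g' t) (at t)"
    and g': "(g' has_real_derivative l) (at a)"
    and max: "\<And>t. g t \<le> g a"
  shows "l \<le> 0"
proof (rule ccontr)
  assume "\<not> l \<le> 0"
  moreover have "g' a = 0"
    using DERIV_local_max[OF g, of 1 a] max by auto
  ultimately obtain d where d: "d > 0" "\<And>h. 0 < h \<Longrightarrow> h < d \<Longrightarrow> 0 < g' (a + h)"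
    using has_real_derivative_pos_inc_right[OF g'] by force
  have "a < a + d/2" using d by simp
  from MVT2[OF this, of g g'] g obtain z where
    z: "a < z" "z < a + d/2" "g (a + d/2) - g a = d/2 * g' z" by auto
  have "0 < g' z" using d(2)[of "z - a"] z by simp
  then have "g (a + d/2) > g a" using z(3) d(1) by (smt (verit) mult_pos_pos half_gt_zero)
  with max[of "a + d/2"] show False by simp
qed

definition cosh_barrier :: "real ^ 'm \<Rightarrow> real"
  where "cosh_barrier x = (\<Sum>i\<in>UNIV. cosh (x $ i))"

text \<open>The largest \<open>\<bar>x\<^sub>i\<bar>\<close> is at least their average, and their sum is at least \<open>norm x\<close>.\<close>

lemma exp_norm_le_cosh_barrier:
  fixes x :: "real ^ 'm"
  shows "exp (norm x / CARD('m)) / 2 \<le> cosh_barrier x"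
proof -
  obtain i where i: "norm x / CARD('m) \<le> \<bar>x $ i\<bar>"
  proof (rule ccontr)
    assume "\<not> thesis"
    with that have less: "\<bar>x $ i\<bar> < norm x / CARD('m)" for i by (meson not_le)
    have "norm x \<le> (\<Sum>i\<in>UNIV. \<bar>x $ i\<bar>)" by (rule norm_le_l1_cart)
    also have "\<dots> < (\<Sum>i\<in>(UNIV::'m set). norm x / CARD('m))"
      by (rule sum_strict_mono) (use less in auto)
    finally show False by simp
  qed
  have "exp (norm x / CARD('m)) / 2 \<le> exp \<bar>x $ i\<bar> / 2" using i by simp
  also have "\<dots> \<le> cosh \<bar>x $ i\<bar>" by (simp add: cosh_field_def)
  also have "\<dots> = cosh (x $ i)" by (simp add: cosh_real_abs)
  also have "\<dots> \<le> cosh_barrier x" unfolding cosh_barrier_def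
    by (rule member_le_sum) (auto intro: cosh_real_nonneg)
  finally show ?thesis .
qed

lemma polynomial_eventually_below_cosh_barrier:
  fixes C \<epsilon> :: real and n :: nat
  assumes "\<epsilon> > 0"
  shows "\<exists>R. \<forall>x :: real ^ 'm. norm x > R \<longrightarrow> C * (1 + norm x) ^ n < \<epsilon> * cosh_barrier x"
proof -
  define m where "m = real CARD('m)"
  have "m > 0" by (simp add: m_def)
  then have "eventually (\<lambda>r. C * (1 + r) ^ n < \<epsilon> * (exp (r / m) / 2)) at_top"
    using assms by real_asymp
  then obtain R where R: "\<And>r. r \<ge> R \<Longrightarrow> C * (1 + r) ^ n < \<epsilon> * (exp (r / m) / 2)"
    by (auto simp: eventually_at_top_linorder)
  have "C * (1 + norm x) ^ n < \<epsilon> * cosh_barrier x" if "norm x > R" for x :: "real ^ 'm"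
  proof -
    have "C * (1 + norm x) ^ n < \<epsilon> * (exp (norm x / m) / 2)" using R that by simp
    also have "\<dots> \<le> \<epsilon> * cosh_barrier x"
      by (rule mult_left_mono) (use assms exp_norm_le_cosh_barrier[of x] in \<open>auto simp: m_def\<close>)
    finally show ?thesis .
  qed
  then show ?thesis by blast
qed

lemma cosh_barrier_along_axis:
  fixes x :: "real ^ 'm"
  shows "cosh_barrier (x + t *\<^sub>R axis i 1) = cosh (x $ i + t) + (\<Sum>j\<in>UNIV - {i}. cosh (x $ j))"
  unfolding cosh_barrier_def
  by (subst sum.remove[of _ i]) (auto simp: axis_def intro!: sum.cong)

text \<open>
  The functions \<open>u1\<close> and \<open>u2\<close> are the first and the pure second partial derivatives of \<open>u\<close>, named
  explicitly so that the statement applies to \<open>-u\<close> as easily as to \<open>u\<close>.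
  At a positive maximum of \<open>u - \<epsilon> w\<close>, with \<open>w\<close> the barrier, comparing the second derivatives
  coordinate by coordinate and summing gives \<open>u \<le> \<nabla>\<^sup>2 u \<le> \<epsilon> w\<close>, a contradiction.
\<close>

lemma polynomially_bounded_subsolution_nonpos:
  fixes u :: "real ^ 'm \<Rightarrow> real"
  assumes cont: "continuous_on UNIV u"
    and u1: "\<And>i x. ((\<lambda>t. u (x + t *\<^sub>R axis i 1)) has_real_derivative u1 i x) (at 0)"
    and u2: "\<And>i x. ((\<lambda>t. u1 i (x + t *\<^sub>R axis i 1)) has_real_derivative u2 i x) (at 0)"
    and sub: "\<And>x. u x \<le> (\<Sum>i\<in>UNIV. u2 i x)"
    and bound: "\<And>x. u x \<le> C * (1 + norm x) ^ n"
  shows "u x \<le> 0"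
proof -
  have below_barrier: "u y \<le> \<epsilon> * cosh_barrier y" if pos: "\<epsilon> > 0" for \<epsilon> y
  proof (rule ccontr)
    define v where "v x = u x - \<epsilon> * cosh_barrier x" for x
    assume "\<not> u y \<le> \<epsilon> * cosh_barrier y"
    then have vy: "v y > 0" by (simp add: v_def)
    obtain R where "\<And>x :: real ^ 'm. norm x > R \<Longrightarrow> C * (1 + norm x) ^ n < \<epsilon> * cosh_barrier x"
      using polynomial_eventually_below_cosh_barrier[OF pos] by blast
    then have outside: "v x < 0" if "norm x > R" for x
      using bound[of x] that unfolding v_def by fastforce
    have y: "y \<in> cball 0 R" using outside[of y] vy by force
    have "continuous_on (cball 0 R) v" unfolding v_def cosh_barrier_def
      by (intro continuous_intros continuous_on_subset[OF cont]) auto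
    then obtain p where "p \<in> cball 0 R" and p: "\<And>x. x \<in> cball 0 R \<Longrightarrow> v x \<le> v p"
      using continuous_attains_sup[of "cball 0 R" v] y compact_cball by blast
    have vp: "v p > 0" using p[OF y] vy by simp
    have max: "v x \<le> v p" for x
      using p[of x] outside[of x] vp by (cases "norm x \<le> R") auto
    have second: "u2 i p \<le> \<epsilon> * cosh (p $ i)" for i
    proof -
      have "u2 i p - \<epsilon> * cosh (p $ i) \<le> 0"
      proof (rule second_derivative_nonpos_at_maximum)
        show "((\<lambda>t. v (p + t *\<^sub>R axis i 1)) has_real_derivative
            u1 i (p + t *\<^sub>R axis i 1) - \<epsilon> * sinh (p $ i + t)) (at t)" for t
        proof -
          have "((\<lambda>s. u (p + s *\<^sub>R axis i 1)) has_real_derivative u1 i (p + t *\<^sub>R axis i 1)) (at t)"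
            using u1[of "p + t *\<^sub>R axis i 1" i]
              DERIV_shift[of "\<lambda>s. u (p + s *\<^sub>R axis i 1)" _ 0 t]
            by (simp add: algebra_simps)
          then show ?thesis unfolding v_def cosh_barrier_along_axis
            by (auto intro!: derivative_eq_intros)
        qed
        show "((\<lambda>t. u1 i (p + t *\<^sub>R axis i 1) - \<epsilon> * sinh (p $ i + t)) has_real_derivative
            u2 i p - \<epsilon> * cosh (p $ i)) (at 0)"
          by (auto intro!: derivative_eq_intros u2)
        show "v (p + t *\<^sub>R axis i 1) \<le> v (p + 0 *\<^sub>R axis i 1)" for t using max by simp
      qed
      then show ?thesis by simp
    qed
    have "u p \<le> (\<Sum>i\<in>UNIV. u2 i p)" by (rule sub)
    also have "\<dots> \<le> \<epsilon> * cosh_barrier p"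
      unfolding cosh_barrier_def sum_distrib_left by (intro sum_mono second)
    finally show False using vp by (simp add: v_def)
  qed
  show ?thesis
  proof (rule ccontr)
    assume "\<not> u x \<le> 0"
    moreover have w: "cosh_barrier x > 0"
      using exp_norm_le_cosh_barrier[of x] by (smt (verit) exp_gt_zero half_gt_zero)
    ultimately show False
      using below_barrier[of "u x / (2 * cosh_barrier x)" x] by simp
  qed
qed

lemma has_partial_deriv:
  assumes "partially_differentiable i f x"
  shows "((\<lambda>t. f (x + t *\<^sub>R axis i 1)) has_real_derivative partial_deriv i f x) (at 0)"
  using assms DERIV_deriv_iff_real_differentiable
  unfolding partially_differentiable_def partial_deriv_def by blast

theorem theorem2p3:
  fixes u :: "real ^ 'm \<Rightarrow> real"
  assumes "CARD('m) \<ge> 2"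
    and "C_k 2 u"
    and "\<forall>x. laplacian u x - u x = 0"
    and "\<exists>C>0. \<exists>n::nat. \<forall>x. \<bar>u x\<bar> \<le> C * (1 + norm x) ^ n"
  shows "\<forall>x. u x = 0"
proof
  fix x
  let ?u1 = "\<lambda>i. partial_deriv i u" and ?u2 = "\<lambda>i. partial_deriv i (partial_deriv i u)"
  have cont: "continuous_on UNIV u"
    and u1: "((\<lambda>t. u (x + t *\<^sub>R axis i 1)) has_real_derivative ?u1 i x) (at 0)"
    and u2: "((\<lambda>t. ?u1 i (x + t *\<^sub>R axis i 1)) has_real_derivative ?u2 i x) (at 0)" for i x
    using assms(2) by (auto simp: numeral_2_eq_2 intro!: has_partial_deriv)
  have eq: "(\<Sum>i\<in>UNIV. ?u2 i x) = u x" for x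
    using assms(3) by (simp add: laplacian_def)
  obtain C and n :: nat where bound: "\<And>x. \<bar>u x\<bar> \<le> C * (1 + norm x) ^ n"
    using assms(4) by blast
  have "u x \<le> 0"
  proof (rule polynomially_bounded_subsolution_nonpos[OF cont u1 u2])
    show "u x \<le> (\<Sum>i\<in>UNIV. ?u2 i x)" for x by (simp add: eq)
    show "u x \<le> C * (1 + norm x) ^ n" for x using bound[of x] by simp
  qed
  moreover have "- u x \<le> 0"
  proof (rule polynomially_bounded_subsolution_nonpos)
    show "continuous_on UNIV (\<lambda>x. - u x)" by (intro continuous_intros cont)
    show "((\<lambda>t. - u (x + t *\<^sub>R axis i 1)) has_real_derivative - ?u1 i x) (at 0)" for i x
      by (rule DERIV_minus[OF u1])
    show "((\<lambda>t. - ?u1 i (x + t *\<^sub>R axis i 1)) has_real_derivative - ?u2 i x) (at 0)" for i x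
      by (rule DERIV_minus[OF u2])
    show "- u x \<le> (\<Sum>i\<in>UNIV. - ?u2 i x)" for x by (simp add: sum_negf eq)
    show "- u x \<le> C * (1 + norm x) ^ n" for x using bound[of x] by simp
  qed
  ultimately show "u x = 0" by simp
qed

end
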